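(* Let $D\in\mathbb{R}^{n\times n}$ be a true squared distance matrix corrupted with additive noise $\tilde D\in\mathbb{R}^{n\times n}$, and let $D_{\mathrm{noisy}}=D+\tilde D$. Let $X$ denote the true Gram matrix (the one corresponding to $D$), and let $\bar X$ be the Gram matrix corresponding to $D_{\mathrm{noisy}}$. Then $$\|\bar X-X\|_\infty<4\|\tilde D\|_\infty ,$$ where $\|\cdot\|_\infty$ gives the largest entry of a matrix in absolute value.
   Context: A squared distance matrix $D$ for $n$ points $p_1,\dots,p_n\in\mathbb{R}^r$ has entries $D_{i,j}=\|p_i-p_j\|^2$. Let $\mathbb{I}=\{(i,j):1\le i<j\le n\}$, of size $L=n(n-1)/2$. The Gram matrix corresponding to a matrix $D$ of (possibly noisy) squared distances is given by the dual basis expansion $\sum_{(i,j)\in\mathbb{I}}D_{i,j}\,v_{i,j}$; thus $X=\sum_{(i,j)\in\mathbb{I}}D_{i,j}\,v_{i,j}$ and $\bar X=\sum_{(i,j)\in\mathbb{I}}[D_{\mathrm{noisy}}]_{i,j}\,v_{i,j}$. The dual basis matrices $v_{i,j}$ are defined as follows. Let $e_{i,j}\in\mathbb{R}^{n\times n}$ be the matrix whose only nonzero entry is a $1$ at position $(i,j)$, and let $\mathbf{1}\in\mathbb{R}^n$ be the all-ones vector. For $\alpha=(\alpha_1,\alpha_2)\in\mathbb{I}$ define $w_\alpha=e_{\alpha_1,\alpha_1}+e_{\alpha_2,\alpha_2}-e_{\alpha_1,\alpha_2}-e_{\alpha_2,\alpha_1}$; these form a basis of the space of symmetric $n\times n$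 matrices $Y$ with $Y\mathbf{1}=0$. With the trace inner product $\langle Y,Z\rangle=\operatorname{trace}(Y^\top Z)$, let $H\in\mathbb{R}^{L\times L}$ have entries $H_{\alpha,\beta}=\langle w_\alpha,w_\beta\rangle$ (this matrix is symmetric positive definite). Then $v_\alpha=\sum_{\beta\in\mathbb{I}}[H^{-1}]_{\alpha,\beta}\,w_\beta$ (written $v_{i,j}$ for $\alpha=(i,j)$), and $\langle v_\alpha,w_\beta\rangle$ equals $1$ if $\alpha=\beta$ and $0$ otherwise.
   Formalization: The noise matrix is assumed to be nonzero: for zero noise both sides equal 0 and the strict inequality fails. *)

theory Defs
  imports "HOL-Analysis.Euclidean_Space" "Jordan_Normal_Form.Gauss_Jordan_Elimination"
begin

text \<open>
  The points are numbered from \<open>0\<close> to \<open>n - 1\<close>. The dimension \<open>r\<close> of the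
  ambient space is \<open>DIM('a)\<close>.
\<close>

definition sq_dist_mat :: "nat \<Rightarrow> (nat \<Rightarrow> 'a::euclidean_space) \<Rightarrow> real mat" where
  "sq_dist_mat n p = mat n n (\<lambda>(i, j). (norm (p i - p j))\<^sup>2)"

definition index_pairs :: "nat \<Rightarrow> (nat \<times> nat) set" where
  "index_pairs n = {(i, j). i < j \<and> j < n}"

definition unit_mat :: "nat \<Rightarrow> nat \<Rightarrow> nat \<Rightarrow> real mat" where
  "unit_mat n i j = mat n n (\<lambda>kl. if kl = (i, j) then 1 else 0)"

definition basis_w :: "nat \<Rightarrow> nat \<times> nat \<Rightarrow> real mat" where
  "basis_w n \<alpha> = unit_mat n (fst \<alpha>) (fst \<alpha>) + unit_mat n (snd \<alpha>) (snd \<alpha>)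
     - unit_mat n (fst \<alpha>) (snd \<alpha>) - unit_mat n (snd \<alpha>) (fst \<alpha>)"

definition mat_trace :: "real mat \<Rightarrow> real" where
  "mat_trace A = (\<Sum>i<dim_row A. A $$ (i, i))"

definition trace_inner :: "real mat \<Rightarrow> real mat \<Rightarrow> real" where
  "trace_inner Y Z = mat_trace (transpose_mat Y * Z)"

text \<open>
  The rows and columns of a \<open>real mat\<close> are numbered by natural numbers, so the
  \<open>L \<times> L\<close> matrix \<open>H\<close> needs an enumeration of the index set. None of the
  entries \<open>H_inv_entry n \<alpha> \<beta>\<close> below depends on which one is chosen.
\<close>

definition pair_list :: "nat \<Rightarrow> (nat \<times> nat) list" where
  "pair_list n = concat (map (\<lambda>i. map (\<lambda>j. (i, j)) [Suc i..<n]) [0..<n])"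

definition pair_pos :: "nat \<Rightarrow> nat \<times> nat \<Rightarrow> nat" where
  "pair_pos n = the_inv_into {..<length (pair_list n)} (nth (pair_list n))"

lemma set_pair_list: "set (pair_list n) = index_pairs n"
  by (force simp: pair_list_def index_pairs_def)

lemma distinct_pair_list: "distinct (pair_list n)"
proof -
  have "distinct (concat (map (\<lambda>i. map (\<lambda>j. (i, j)) [Suc i..<n]) xs))"
    if "distinct xs" for xs :: "nat list"
    using that by (induction xs) (auto simp: distinct_map inj_on_def)
  then show ?thesis
    unfolding pair_list_def by simp
qed

lemma length_pair_list: "length (pair_list n) = n * (n - 1) div 2"
proof -
  have a: "length (pair_list n) = (\<Sum>i<n. n - Suc i)"
    by (simp add: pair_list_def length_concat comp_def interv_sum_list_conv_sum_set_nat atLeast0LessThan)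
  also have "\<dots> = \<Sum>{..<n}"
    by (rule sum.nat_diff_reindex)
  also have "\<dots> = n * (n - 1) div 2"
    by (cases n) (simp_all add: gauss_sum lessThan_Suc_atMost atLeast0AtMost[symmetric] gauss_sum_nat mult.commute)
  finally show ?thesis .
qed

lemma bij_betw_pair_pos:
  "bij_betw (pair_pos n) (index_pairs n) {..<length (pair_list n)}"
  unfolding pair_pos_def
  by (rule bij_betw_the_inv_into)
     (metis bij_betw_nth distinct_pair_list set_pair_list)

definition H_mat :: "nat \<Rightarrow> real mat" where
  "H_mat n = mat (length (pair_list n)) (length (pair_list n))
     (\<lambda>(a, b). trace_inner (basis_w n (pair_list n ! a)) (basis_w n (pair_list n ! b)))"

definition H_inv_entry :: "nat \<Rightarrow> nat \<times> nat \<Rightarrow> nat \<times> nat \<Rightarrow> real" where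
  "H_inv_entry n \<alpha> \<beta> = the (mat_inverse (H_mat n)) $$ (pair_pos n \<alpha>, pair_pos n \<beta>)"

lemma H_mat_entry:
  assumes "\<alpha> \<in> index_pairs n" "\<beta> \<in> index_pairs n"
  shows "H_mat n $$ (pair_pos n \<alpha>, pair_pos n \<beta>) = trace_inner (basis_w n \<alpha>) (basis_w n \<beta>)"
proof -
  have lt: "pair_pos n \<gamma> < length (pair_list n)" if "\<gamma> \<in> index_pairs n" for \<gamma>
    using bij_betwE[OF bij_betw_pair_pos] that by blast
  have "bij_betw (nth (pair_list n)) {..<length (pair_list n)} (index_pairs n)"
    by (metis bij_betw_nth distinct_pair_list set_pair_list)
  then have nth: "pair_list n ! pair_pos n \<gamma> = \<gamma>" if "\<gamma> \<in> index_pairs n" for \<gamma>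
    using that unfolding pair_pos_def by (simp add: f_the_inv_into_f_bij_betw)
  show ?thesis
    using assms by (simp add: H_mat_def lt nth)
qed

text \<open>
  The type \<open>real mat\<close> contains matrices of all sizes and hence has no \<open>0\<close>;
  linear combinations of \<open>n \<times> n\<close> matrices are therefore written entrywise.
\<close>

definition mat_lincomb ::
    "nat \<Rightarrow> ('i \<Rightarrow> real) \<Rightarrow> ('i \<Rightarrow> real mat) \<Rightarrow> 'i set \<Rightarrow> real mat" where
  "mat_lincomb n c M S = mat n n (\<lambda>kl. \<Sum>\<alpha>\<in>S. c \<alpha> * M \<alpha> $$ kl)"

definition dual_v :: "nat \<Rightarrow> nat \<times> nat \<Rightarrow> real mat" where
  "dual_v n \<alpha> = mat_lincomb n (H_inv_entry n \<alpha>) (basis_w n) (index_pairs n)"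

definition gram_mat :: "nat \<Rightarrow> real mat \<Rightarrow> real mat" where
  "gram_mat n D = mat_lincomb n (\<lambda>\<alpha>. D $$ \<alpha>) (dual_v n) (index_pairs n)"

definition max_norm :: "real mat \<Rightarrow> real" where
  "max_norm A = Max (abs ` elements_mat A)"

end

theory Submission
  imports Defs "Jordan_Normal_Form.Determinant"
begin

text \<open>
  Let \<open>J = I - (1/n) 1 1\<^sup>T\<close> be the centering matrix. The dual basis has the closed form
  \<open>v\<^bsub>(i,j)\<^esub> = - 1/2 J (e\<^bsub>i,j\<^esub> + e\<^bsub>j,i\<^esub>) J\<close>, so the Gram matrix of the perturbation is the
  double centering \<open>- 1/2 J S J\<close>, where \<open>S\<close> is the symmetric matrix with zero diagonal that agrees
  with the noise above the diagonal. Each row of \<open>J\<close> has absolute sum \<open>2 - 2/n\<close>. An entry of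
  \<open>J S J\<close> is therefore at most \<open>2 \<cdot> 2\<close> times the largest noise entry, and an entry of the Gram matrix
  at most \<open>2\<close> times. This constant \<open>2\<close> lies below the claimed \<open>4\<close>, and as the noise is
  not zero, its norm is positive and the inequality is strict.

  The closed form comes from inverting \<open>H\<close> explicitly. A symmetric matrix \<open>Y\<close> with zero row sums
  is determined by its entries off the diagonal, and its coordinates in the basis \<open>w\<close> are
  \<open>- Y\<^bsub>a,b\<^esub>\<close> (lemma \<open>expand_in_basis_w\<close>). Applied to the candidate for \<open>v\<^sub>\<alpha>\<close>, this
  gives a candidate for the row \<open>\<alpha>\<close> of the inverse of \<open>H\<close>. That it is the right one
  (lemma \<open>H_inv_entry_eq\<close>) amounts to the orthogonality relation \<open>\<langle>v\<^sub>\<alpha>, w\<^sub>\<gamma>\<rangle> = \<delta>\<^bsub>\<alpha>\<gamma>\<^esub>\<close>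
  for the candidates (lemma \<open>dual_entry_biorthogonal\<close>).
\<close>

section \<open>The basis matrices as rank-one matrices\<close>

text \<open>
  The vector \<open>u\<close> with \<open>w\<^sub>\<alpha> = u u\<^sup>T\<close>, the column of \<open>\<alpha>\<close> in the incidence matrix of the complete
  graph.
\<close>

definition edge_vec :: "nat \<times> nat \<Rightarrow> nat \<Rightarrow> real" where
  "edge_vec \<alpha> k = of_bool (k = fst \<alpha>) - of_bool (k = snd \<alpha>)"

text \<open>The entry \<open>(k, i)\<close> of the orthogonal projection onto the vectors with zero sum.\<close>

definition centering :: "nat \<Rightarrow> nat \<Rightarrow> nat \<Rightarrow> real" where
  "centering n k i = of_bool (k = i) - 1 / real n"

text \<open>
  The entry \<open>(k, l)\<close> of \<open>- 1/2 J (e\<^bsub>i,j\<^esub> + e\<^bsub>j,i\<^esub>) J\<close> for \<open>\<alpha> = (i, j)\<close>. It is a function of the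
  entries of \<open>J\<close> rather than a matrix product, so that every later identity is one between finite sums.
\<close>

definition dual_entry :: "nat \<Rightarrow> nat \<times> nat \<Rightarrow> nat \<Rightarrow> nat \<Rightarrow> real" where
  "dual_entry n \<alpha> k l =
     - (centering n k (fst \<alpha>) * centering n l (snd \<alpha>)
        + centering n k (snd \<alpha>) * centering n l (fst \<alpha>)) / 2"

lemma finite_index_pairs: "finite (index_pairs n)"
  by (metis List.finite_set set_pair_list)

lemma sum_square_split:
  fixes f :: "nat \<Rightarrow> nat \<Rightarrow> real"
  shows "(\<Sum>i<n. \<Sum>j<n. f i j) =
    (\<Sum>\<alpha>\<in>index_pairs n. f (fst \<alpha>) (snd \<alpha>) + f (snd \<alpha>) (fst \<alpha>)) + (\<Sum>i<n. f i i)"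
proof (induction n)
  case 0
  show ?case by (simp add: index_pairs_def)
next
  case (Suc n)
  have split: "index_pairs (Suc n) = index_pairs n \<union> (\<lambda>i. (i, n)) ` {..<n}"
    by (auto simp: index_pairs_def less_Suc_eq)
  have disj: "index_pairs n \<inter> (\<lambda>i. (i, n)) ` {..<n} = {}"
    by (auto simp: index_pairs_def)
  have inj: "inj_on (\<lambda>i. (i, n)) {..<n}" by (auto simp: inj_on_def)
  show ?case
    unfolding split
    by (subst sum.union_disjoint[OF finite_index_pairs _ disj])
       (simp_all add: sum.reindex[OF inj] sum.distrib Suc.IH)
qed

lemma basis_w_carrier: "basis_w n \<alpha> \<in> carrier_mat n n"
  by (auto simp: basis_w_def unit_mat_def intro!: minus_carrier_mat)

lemma basis_w_entry:
  assumes "\<alpha> \<in> index_pairs n" "k < n" "l < n"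
  shows "basis_w n \<alpha> $$ (k, l) = edge_vec \<alpha> k * edge_vec \<alpha> l"
  using assms by (auto simp: basis_w_def unit_mat_def edge_vec_def index_pairs_def)

lemma trace_inner_sum:
  assumes "Y \<in> carrier_mat n n" "Z \<in> carrier_mat n n"
  shows "trace_inner Y Z = (\<Sum>k<n. \<Sum>l<n. Y $$ (k, l) * Z $$ (k, l))"
proof -
  have "trace_inner Y Z = (\<Sum>l<n. \<Sum>k<n. Y $$ (k, l) * Z $$ (k, l))"
    using assms unfolding trace_inner_def mat_trace_def
    by (auto simp: scalar_prod_def atLeast0LessThan intro!: sum.cong)
  also have "\<dots> = (\<Sum>k<n. \<Sum>l<n. Y $$ (k, l) * Z $$ (k, l))"
    by (rule sum.swap)
  finally show ?thesis .
qed

text \<open>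
  The product of \<open>edge_vec\<close> entries vanishes on loops and is symmetric under reversal of the edge, so
  twice the sum over pairs is a sum over all of \<open>{..<n} \<times> {..<n}\<close>. There each off-diagonal position
  receives \<open>- Y k l\<close> from both orientations of the edge, while the diagonal positions collect row
  sums, which is where the assumption of zero row sums enters.
\<close>

lemma expand_in_basis_w:
  fixes Y :: "nat \<Rightarrow> nat \<Rightarrow> real"
  assumes sym: "\<And>i j. Y i j = Y j i"
    and zero: "\<And>i. i < n \<Longrightarrow> (\<Sum>j<n. Y i j) = 0"
    and k: "k < n" and l: "l < n"
  shows "(\<Sum>\<beta>\<in>index_pairs n. - Y (fst \<beta>) (snd \<beta>) * (edge_vec \<beta> k * edge_vec \<beta> l)) = Y k l"
proof -
  let ?f = "\<lambda>i j. Y i j * (edge_vec (i, j) k * edge_vec (i, j) l)"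
  have f_sym: "?f (snd \<beta>) (fst \<beta>) = ?f (fst \<beta>) (snd \<beta>)" for \<beta>
    using sym[of "fst \<beta>" "snd \<beta>"] by (simp add: edge_vec_def algebra_simps)
  have f_diag: "?f i i = 0" for i by (simp add: edge_vec_def)
  have "(\<Sum>i<n. \<Sum>j<n. ?f i j) = 2 * (\<Sum>\<beta>\<in>index_pairs n. ?f (fst \<beta>) (snd \<beta>))"
    unfolding sum_square_split f_sym f_diag sum_distrib_left
    by (simp add: algebra_simps)
  moreover have "(\<Sum>i<n. \<Sum>j<n. ?f i j) = - 2 * Y k l"
  proof -
    \<comment> \<open>On a loop \<open>i = j\<close> the four terms cancel, so the first two may run over a full row of \<open>Y\<close>.\<close>
    have prod: "?f i j =
        (if i = k then of_bool (k = l) * Y k j else 0)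
        + (if j = k then of_bool (k = l) * Y k i else 0)
        - (if i = k then if j = l then Y k l else 0 else 0)
        - (if i = l then if j = k then Y k l else 0 else 0)" for i j
      using sym[of k l] sym[of k i] by (auto simp: edge_vec_def)
    have if_sum: "(\<Sum>j<n. if b then g j else 0) = (if b then \<Sum>j<n. g j else 0)"
      for b and g :: "nat \<Rightarrow> real" by simp
    show ?thesis
      unfolding prod using k l zero
      by (simp add: sum.distrib sum_subtractf if_sum sum_distrib_left[symmetric])
  qed
  ultimately show ?thesis by (simp add: sum_negf)
qed

section \<open>The closed form of the dual basis\<close>

lemma sum_centering:
  assumes "i < n" shows "(\<Sum>k<n. centering n k i) = 0"
  using assms by (simp add: centering_def sum_subtractf of_bool_def)

text \<open>
  Row \<open>k\<close> is a unit vector minus the uniform distribution, so the triangle inequality gives \<open>1 + 1\<close>.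
\<close>

lemma sum_abs_centering:
  assumes "k < n" shows "(\<Sum>i<n. \<bar>centering n k i\<bar>) \<le> 2"
proof -
  have "(\<Sum>i<n. \<bar>centering n k i\<bar>) \<le> (\<Sum>i<n. of_bool (k = i) + 1 / real n)"
    by (intro sum_mono) (simp add: centering_def)
  also have "\<dots> = 2" using assms by (simp add: sum.distrib of_bool_def)
  finally show ?thesis .
qed

lemma dual_entry_sym: "dual_entry n \<alpha> k l = dual_entry n \<alpha> l k"
  by (simp add: dual_entry_def)

lemma dual_entry_row_sum:
  assumes "\<alpha> \<in> index_pairs n"
  shows "(\<Sum>l<n. dual_entry n \<alpha> k l) = 0"
proof -
  have "fst \<alpha> < n" "snd \<alpha> < n" using assms by (auto simp: index_pairs_def)
  then show ?thesis
    by (simp add: dual_entry_def sum_divide_distrib[symmetric] sum_negf sum_subtractf sum.distrib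
        sum_distrib_left[symmetric] sum_centering)
qed

text \<open>The projection fixes \<open>edge_vec \<alpha>\<close>, whose entries sum to zero.\<close>

lemma centering_edge_vec:
  assumes "\<alpha> \<in> index_pairs n" "i < n"
  shows "(\<Sum>k<n. centering n k i * edge_vec \<alpha> k) = edge_vec \<alpha> i"
proof -
  obtain a b where \<alpha>: "\<alpha> = (a, b)" "a < n" "b < n"
    using assms by (auto simp: index_pairs_def)
  have total: "(\<Sum>k<n. edge_vec \<alpha> k) = 0"
    using \<alpha> by (simp add: edge_vec_def sum_subtractf of_bool_def)
  have "(\<Sum>k<n. centering n k i * edge_vec \<alpha> k)
      = (\<Sum>k<n. if k = i then edge_vec \<alpha> k else 0) - 1 / real n * (\<Sum>k<n. edge_vec \<alpha> k)"
    unfolding sum_distrib_left sum_subtractf[symmetric]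
    by (intro sum.cong) (auto simp: centering_def algebra_simps)
  then show ?thesis using assms total by simp
qed

text \<open>
  The left-hand side is \<open>u\<^sup>T v\<^sub>\<alpha> u\<close> for \<open>u = edge_vec \<gamma>\<close>. As \<open>J u = u\<close>, it reduces to
  \<open>- u\<^sub>i u\<^sub>j\<close> for \<open>\<alpha> = (i, j)\<close>. With \<open>i \<noteq> j\<close> this product is nonzero only if \<open>i\<close> and \<open>j\<close> are the two
  ends of \<open>\<gamma>\<close>, and then the two factors have opposite signs.
\<close>

lemma dual_entry_biorthogonal:
  assumes \<alpha>: "\<alpha> \<in> index_pairs n" and \<gamma>: "\<gamma> \<in> index_pairs n"
  shows "(\<Sum>k<n. \<Sum>l<n. dual_entry n \<alpha> k l * (edge_vec \<gamma> k * edge_vec \<gamma> l)) = of_bool (\<alpha> = \<gamma>)"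
proof -
  obtain i j where ij: "\<alpha> = (i, j)" "i < j" "j < n" using \<alpha> by (auto simp: index_pairs_def)
  have lt: "i < n" "j < n" using ij by auto
  let ?c = "\<lambda>i k. centering n k i * edge_vec \<gamma> k"
  have "(\<Sum>k<n. \<Sum>l<n. dual_entry n \<alpha> k l * (edge_vec \<gamma> k * edge_vec \<gamma> l))
      = (\<Sum>k<n. \<Sum>l<n. - (1/2) * (?c i k * ?c j l + ?c j k * ?c i l))"
    by (intro sum.cong refl) (simp add: dual_entry_def ij(1) field_simps)
  also have "\<dots> = - (1/2) * (\<Sum>k<n. \<Sum>l<n. ?c i k * ?c j l + ?c j k * ?c i l)"
    by (simp only: sum_distrib_left)
  also have "\<dots> = - (1/2) * ((\<Sum>k<n. ?c i k) * (\<Sum>l<n. ?c j l) + (\<Sum>k<n. ?c j k) * (\<Sum>l<n. ?c i l))"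
    by (simp only: sum_product sum.distrib)
  also have "\<dots> = - (edge_vec \<gamma> i * edge_vec \<gamma> j)"
    using lt by (simp add: centering_edge_vec[OF \<gamma>])
  also have "\<dots> = of_bool (\<alpha> = \<gamma>)"
    using ij(2) \<gamma> by (cases \<gamma>) (auto simp: ij(1) edge_vec_def index_pairs_def)
  finally show ?thesis .
qed

lemma mat_inverse_eqI:
  fixes A B :: "'a::field mat"
  assumes A: "A \<in> carrier_mat m m" and B: "B \<in> carrier_mat m m" and BA: "B * A = 1\<^sub>m m"
  shows "mat_inverse A = Some B"
proof -
  have AB: "A * B = 1\<^sub>m m" by (rule mat_mult_left_right_inverse[OF B A BA])
  show ?thesis
  proof (cases "mat_inverse A")
    case None
    have "A \<in> Units (ring_mat TYPE('a) m ())"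
      using A B AB BA unfolding Units_def ring_mat_def by auto
    then show ?thesis using mat_inverse(1)[OF A None, of "()"] by blast
  next
    case (Some C)
    then have C: "C * A = 1\<^sub>m m" "C \<in> carrier_mat m m" using mat_inverse(2)[OF A] by auto
    have "C = C * (A * B)" using AB C by simp
    also have "\<dots> = (C * A) * B" by (rule assoc_mult_mat[OF C(2) A B, symmetric])
    also have "\<dots> = B" using B C by simp
    finally show ?thesis using Some by simp
  qed
qed

text \<open>
  Row \<open>\<alpha>\<close> of the candidate \<open>K\<close> lists the coordinates of \<open>v\<^sub>\<alpha>\<close> in the basis \<open>w\<close>. Its product with
  column \<open>\<gamma>\<close> of \<open>H\<close> is thus \<open>\<langle>v\<^sub>\<alpha>, w\<^sub>\<gamma>\<rangle>\<close> by linearity of the inner product, so \<open>K H = I\<close>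
  is exactly biorthogonality. A one-sided inverse suffices because \<open>H\<close> is square.
\<close>

lemma H_inv_entry_eq:
  assumes \<alpha>: "\<alpha> \<in> index_pairs n" and \<beta>: "\<beta> \<in> index_pairs n"
  shows "H_inv_entry n \<alpha> \<beta> = - dual_entry n \<alpha> (fst \<beta>) (snd \<beta>)"
proof -
  define L where "L = length (pair_list n)"
  define P where "P = (\<lambda>a. pair_list n ! a)"
  define K where "K = mat L L (\<lambda>(a, b). - dual_entry n (P a) (fst (P b)) (snd (P b)))"
  have bij: "bij_betw P {..<L} (index_pairs n)"
    unfolding P_def L_def by (metis bij_betw_nth distinct_pair_list set_pair_list)
  have P: "P a \<in> index_pairs n" if "a < L" for a
    using bij that by (auto dest: bij_betwE)
  have pos: "pair_pos n \<gamma> < L" "P (pair_pos n \<gamma>) = \<gamma>" if "\<gamma> \<in> index_pairs n" for \<gamma>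
    using that bij_betwE[OF bij_betw_pair_pos] bij
    by (auto simp: L_def P_def pair_pos_def f_the_inv_into_f_bij_betw)
  have H: "H_mat n \<in> carrier_mat L L" by (simp add: H_mat_def L_def)
  have K: "K \<in> carrier_mat L L" by (simp add: K_def)
  have "K * H_mat n = 1\<^sub>m L"
  proof (rule eq_matI)
    fix a c assume "a < dim_row (1\<^sub>m L)" "c < dim_col (1\<^sub>m L)"
    then have a: "a < L" and c: "c < L" by auto
    have "(K * H_mat n) $$ (a, c)
        = (\<Sum>b<L. - dual_entry n (P a) (fst (P b)) (snd (P b))
             * trace_inner (basis_w n (P b)) (basis_w n (P c)))"
      using a c by (auto simp: K_def H_mat_def L_def P_def scalar_prod_def atLeast0LessThan
          intro!: sum.cong)
    also have "\<dots> = (\<Sum>\<beta>\<in>index_pairs n. - dual_entry n (P a) (fst \<beta>) (snd \<beta>)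
             * trace_inner (basis_w n \<beta>) (basis_w n (P c)))"
      by (rule sum.reindex_bij_betw[OF bij])
    also have "\<dots> = (\<Sum>\<beta>\<in>index_pairs n. \<Sum>k<n. \<Sum>l<n.
             (- dual_entry n (P a) (fst \<beta>) (snd \<beta>) * (edge_vec \<beta> k * edge_vec \<beta> l))
               * (edge_vec (P c) k * edge_vec (P c) l))"
      using P[OF c]
      by (simp add: trace_inner_sum[OF basis_w_carrier basis_w_carrier] basis_w_entry
          sum_distrib_left mult.assoc)
    also have "\<dots> = (\<Sum>k<n. \<Sum>\<beta>\<in>index_pairs n. \<Sum>l<n.
             (- dual_entry n (P a) (fst \<beta>) (snd \<beta>) * (edge_vec \<beta> k * edge_vec \<beta> l))
               * (edge_vec (P c) k * edge_vec (P c) l))"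
      by (rule sum.swap)
    also have "\<dots> = (\<Sum>k<n. \<Sum>l<n.
             (\<Sum>\<beta>\<in>index_pairs n. - dual_entry n (P a) (fst \<beta>) (snd \<beta>) * (edge_vec \<beta> k * edge_vec \<beta> l))
               * (edge_vec (P c) k * edge_vec (P c) l))"
      unfolding sum_distrib_right by (rule sum.cong[OF refl], rule sum.swap)
    also have "\<dots> = (\<Sum>k<n. \<Sum>l<n. dual_entry n (P a) k l * (edge_vec (P c) k * edge_vec (P c) l))"
      by (intro sum.cong refl arg_cong2[where f = "(*)"] expand_in_basis_w)
         (auto simp: dual_entry_row_sum[OF P[OF a]] intro: dual_entry_sym)
    also have "\<dots> = of_bool (P a = P c)"
      by (rule dual_entry_biorthogonal[OF P[OF a] P[OF c]])
    also have "\<dots> = 1\<^sub>m L $$ (a, c)"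
      using a c bij by (auto simp: bij_betw_def inj_on_def)
    finally show "(K * H_mat n) $$ (a, c) = 1\<^sub>m L $$ (a, c)" .
  qed (use H K in auto)
  then have "mat_inverse (H_mat n) = Some K" by (rule mat_inverse_eqI[OF H K])
  then show ?thesis
    using pos[OF \<alpha>] pos[OF \<beta>] by (simp add: H_inv_entry_def K_def)
qed

lemma dual_v_entry:
  assumes \<alpha>: "\<alpha> \<in> index_pairs n" and kl: "k < n" "l < n"
  shows "dual_v n \<alpha> $$ (k, l) = dual_entry n \<alpha> k l"
proof -
  have "dual_v n \<alpha> $$ (k, l)
      = (\<Sum>\<beta>\<in>index_pairs n. - dual_entry n \<alpha> (fst \<beta>) (snd \<beta>) * (edge_vec \<beta> k * edge_vec \<beta> l))"
    using kl by (simp add: dual_v_def mat_lincomb_def H_inv_entry_eq[OF \<alpha>] basis_w_entry)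
  also have "\<dots> = dual_entry n \<alpha> k l"
    by (rule expand_in_basis_w[OF dual_entry_sym dual_entry_row_sum[OF \<alpha>] kl])
  finally show ?thesis .
qed

section \<open>The entrywise bound\<close>

text \<open>
  The sum is the norm of the linear functional that takes the noise (with the maximum norm) to one
  entry of the Gram matrix. The two terms of \<open>v\<^bsub>(i,j)\<^esub>\<close> belong to the ordered pairs \<open>(i, j)\<close> and \<open>(j, i)\<close>, so the
  sum is at most half of the full double sum, which factors into two absolute row sums of \<open>J\<close>.
\<close>

lemma sum_abs_dual_entry:
  assumes k: "k < n" and l: "l < n"
  shows "(\<Sum>\<alpha>\<in>index_pairs n. \<bar>dual_entry n \<alpha> k l\<bar>) \<le> 2"
proof -
  let ?g = "\<lambda>i j. \<bar>centering n k i\<bar> * \<bar>centering n l j\<bar>"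
  have "2 * (\<Sum>\<alpha>\<in>index_pairs n. \<bar>dual_entry n \<alpha> k l\<bar>)
      \<le> (\<Sum>\<alpha>\<in>index_pairs n. ?g (fst \<alpha>) (snd \<alpha>) + ?g (snd \<alpha>) (fst \<alpha>))"
    unfolding sum_distrib_left
  proof (rule sum_mono)
    fix \<alpha> :: "nat \<times> nat"
    have "2 * \<bar>dual_entry n \<alpha> k l\<bar> = \<bar>centering n k (fst \<alpha>) * centering n l (snd \<alpha>)
        + centering n k (snd \<alpha>) * centering n l (fst \<alpha>)\<bar>"
      by (simp add: dual_entry_def)
    then show "2 * \<bar>dual_entry n \<alpha> k l\<bar> \<le> ?g (fst \<alpha>) (snd \<alpha>) + ?g (snd \<alpha>) (fst \<alpha>)"
      by (metis abs_mult abs_triangle_ineq)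
  qed
  also have "\<dots> \<le> (\<Sum>i<n. \<Sum>j<n. ?g i j)"
    unfolding sum_square_split by (simp add: sum_nonneg)
  also have "\<dots> = (\<Sum>i<n. \<bar>centering n k i\<bar>) * (\<Sum>j<n. \<bar>centering n l j\<bar>)"
    by (simp add: sum_product)
  also have "\<dots> \<le> 2 * 2"
    by (intro mult_mono sum_abs_centering k l sum_nonneg) simp_all
  finally show ?thesis by simp
qed

lemma abs_le_max_norm:
  assumes "A \<in> carrier_mat r c" "i < r" "j < c"
  shows "\<bar>A $$ (i, j)\<bar> \<le> max_norm A"
  unfolding max_norm_def
proof (rule Max_ge)
  show "finite (abs ` elements_mat A)" by (simp add: elements_mat_def)
  show "\<bar>A $$ (i, j)\<bar> \<in> abs ` elements_mat A"
    using elements_matI[OF assms refl] by (rule imageI)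
qed

lemma max_norm_le:
  assumes A: "A \<in> carrier_mat r c" and "r > 0" "c > 0"
    and bound: "\<And>i j. i < r \<Longrightarrow> j < c \<Longrightarrow> \<bar>A $$ (i, j)\<bar> \<le> M"
  shows "max_norm A \<le> M"
  unfolding max_norm_def
proof (rule Max.boundedI)
  have "A $$ (0, 0) \<in> elements_mat A" using elements_matI[OF A \<open>r > 0\<close> \<open>c > 0\<close> refl] .
  then show "abs ` elements_mat A \<noteq> {}" by blast
qed (use A bound in \<open>auto simp: elements_mat_def\<close>)

theorem claim6:
  fixes n :: nat
    and p :: "nat \<Rightarrow> 'a::euclidean_space"
    and D D_noise D_noisy X X_bar :: "real mat"
  assumes "D = sq_dist_mat n p"
    and "D_noise \<in> carrier_mat n n"
    and "D_noise \<noteq> 0\<^sub>m n n"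
    and "D_noisy = D + D_noise"
    and "X = gram_mat n D"
    and "X_bar = gram_mat n D_noisy"
  shows "max_norm (X_bar - X) < 4 * max_norm D_noise"
proof -
  let ?M = "max_norm D_noise"
  have D: "D \<in> carrier_mat n n" using assms(1) by (simp add: sq_dist_mat_def)
  obtain i j where ij: "i < n" "j < n" "D_noise $$ (i, j) \<noteq> 0"
    using assms(2,3) by (metis carrier_matD eq_matI index_zero_mat)
  then have M_pos: "?M > 0"
    using abs_le_max_norm[OF assms(2) ij(1,2)] by linarith
  have "max_norm (X_bar - X) \<le> 2 * ?M"
  proof (rule max_norm_le)
    show "X_bar - X \<in> carrier_mat n n"
      by (simp add: assms(5,6) gram_mat_def mat_lincomb_def minus_mat_def)
    show "n > 0" "n > 0" using ij by auto
  next
    fix k l assume kl: "k < n" "l < n"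
    have "(X_bar - X) $$ (k, l) = (\<Sum>\<alpha>\<in>index_pairs n. (D_noisy $$ \<alpha> - D $$ \<alpha>) * dual_entry n \<alpha> k l)"
      using kl by (simp add: assms(5,6) gram_mat_def mat_lincomb_def dual_v_entry
          sum_subtractf left_diff_distrib)
    also have "\<dots> = (\<Sum>\<alpha>\<in>index_pairs n. D_noise $$ \<alpha> * dual_entry n \<alpha> k l)"
      using D assms(2) by (intro sum.cong refl) (auto simp: assms(4) index_pairs_def)
    finally have "\<bar>(X_bar - X) $$ (k, l)\<bar> \<le> (\<Sum>\<alpha>\<in>index_pairs n. \<bar>D_noise $$ \<alpha>\<bar> * \<bar>dual_entry n \<alpha> k l\<bar>)"
      by (simp only: abs_mult[symmetric] sum_abs)
    also have "\<dots> \<le> (\<Sum>\<alpha>\<in>index_pairs n. ?M * \<bar>dual_entry n \<alpha> k l\<bar>)"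
      by (intro sum_mono mult_right_mono)
         (auto simp: index_pairs_def intro!: abs_le_max_norm[OF assms(2)])
    also have "\<dots> \<le> ?M * 2"
      unfolding sum_distrib_left[symmetric] using M_pos sum_abs_dual_entry[OF kl]
      by (intro mult_left_mono) auto
    finally show "\<bar>(X_bar - X) $$ (k, l)\<bar> \<le> 2 * ?M" by simp
  qed
  then show ?thesis using M_pos by linarith
qed

end
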